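(* Let $\mathcal X\neq\{\theta\}$ be a linear space over the field $\mathbb K$ of real or complex numbers. Any two norms $f,g$ on $\mathcal X$ are equivalent if and only if $C_f(g)\,C_g(f)\neq 0$.
   Context: Let $\mathcal N(\mathcal X)$ be the set of all norms on $\mathcal X$ together with the constant zero function $O$, with operations $(f+g)(x)=f(x)+g(x)$, $(\alpha f)(x)=|\alpha|f(x)$ for $\alpha\in\mathbb K$, and order $f\le g$ iff $f(x)\le g(x)$ for all $x\in\mathcal X$. For $f,g\in\mathcal N(\mathcal X)$ the comparing spectrum of $g$ relative to $f$ is $\sigma_f(g):=\{\lambda\in\mathbb K:\lambda f\le g\}=\{\lambda\in\mathbb K: |\lambda|f(x)\le g(x)\ \text{for all } x\in\mathcal X\}$. For $f\ne O$ this set is nonempty and bounded, and the comparing function relative to $f$ is $C_f(g):=\sup_{\lambda\in\sigma_f(g)}|\lambda|\in[0,\infty)$. Two norms $f,g$ on $\mathcal X$ are equivalent if there exist $\lambda,\mu>0$ with $\lambda f(x)\le g(x)\le\mu f(x)$ for all $x\in\mathcal X$. *)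

theory Defs
  imports Complex_Main
begin

text \<open>
  The linear space is given by a type of vectors together with an explicit scalar multiplication
  satisfying \<open>vector_space\<close>, since it carries several norms at once and none of them is
  distinguished. The scalar field is a type of class \<open>real_normed_field\<close>, to be instantiated by
  \<open>real\<close> and \<open>complex\<close>, on which \<open>norm\<close> is the absolute value.
\<close>

definition is_norm :: "('k::real_normed_field \<Rightarrow> 'a::ab_group_add \<Rightarrow> 'a) \<Rightarrow> ('a \<Rightarrow> real) \<Rightarrow> bool" where
  "is_norm scale f \<longleftrightarrow>
     (\<forall>x. 0 \<le> f x) \<and>
     (\<forall>x. f x = 0 \<longleftrightarrow> x = 0) \<and>
     (\<forall>a x. f (scale a x) = norm a * f x) \<and>
     (\<forall>x y. f (x + y) \<le> f x + f y)"

definition norms_and_zero :: "('k::real_normed_field \<Rightarrow> 'a::ab_group_add \<Rightarrow> 'a) \<Rightarrow> ('a \<Rightarrow> real) set" where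
  "norms_and_zero scale = insert (\<lambda>_. 0) {f. is_norm scale f}"

definition fun_scale :: "'k::real_normed_field \<Rightarrow> ('a \<Rightarrow> real) \<Rightarrow> 'a \<Rightarrow> real" where
  "fun_scale a f = (\<lambda>x. norm a * f x)"

text \<open>The order used here is the pointwise one on functions.\<close>

definition comparing_spectrum :: "('a \<Rightarrow> real) \<Rightarrow> ('a \<Rightarrow> real) \<Rightarrow> 'k::real_normed_field set" where
  "comparing_spectrum f g = {a. fun_scale a f \<le> g}"

text \<open>
  \<open>comparing_function TYPE('k) f g\<close> is \<open>C\<^sub>f(g)\<close>. The first argument names the scalar field, which
  cannot be read off from \<open>f\<close> and \<open>g\<close>. The supremum is the one on \<open>real\<close>, so it is meaningful
  only for a nonempty bounded spectrum; see the two lemmas below.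
\<close>

definition comparing_function ::
    "'k::real_normed_field itself \<Rightarrow> ('a \<Rightarrow> real) \<Rightarrow> ('a \<Rightarrow> real) \<Rightarrow> real" where
  "comparing_function _ f g = (SUP a \<in> (comparing_spectrum f g :: 'k set). norm a)"

definition equivalent_norms :: "('a \<Rightarrow> real) \<Rightarrow> ('a \<Rightarrow> real) \<Rightarrow> bool" where
  "equivalent_norms f g \<longleftrightarrow> (\<exists>l>0. \<exists>m>0. \<forall>x. l * f x \<le> g x \<and> g x \<le> m * f x)"

lemma norms_and_zero_nonneg: "f \<in> norms_and_zero scale \<Longrightarrow> 0 \<le> f x"
  by (auto simp: norms_and_zero_def is_norm_def)

lemma comparing_spectrum_nonempty:
  assumes "g \<in> norms_and_zero scale"
  shows "(comparing_spectrum f g :: 'k::real_normed_field set) \<noteq> {}"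
proof -
  have "(0::'k) \<in> comparing_spectrum f g"
    using norms_and_zero_nonneg[OF assms]
    by (simp add: comparing_spectrum_def fun_scale_def le_fun_def)
  then show ?thesis by blast
qed

lemma comparing_spectrum_bdd_above:
  assumes "f \<in> norms_and_zero scale" "f \<noteq> (\<lambda>_. 0)"
  shows "bdd_above (norm ` (comparing_spectrum f g :: 'k::real_normed_field set))"
proof -
  from assms(2) obtain x where "f x \<noteq> 0" by auto
  with norms_and_zero_nonneg[OF assms(1)] have "0 < f x" by (simp add: less_le)
  show ?thesis
  proof (rule bdd_aboveI2)
    fix a :: 'k assume "a \<in> comparing_spectrum f g"
    then have "norm a * f x \<le> g x"
      by (simp add: comparing_spectrum_def fun_scale_def le_fun_def)
    with \<open>0 < f x\<close> show "norm a \<le> g x / f x" by (simp add: field_simps)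
  qed
qed

end

theory Submission
  imports Defs
begin

text \<open>
  Equivalence of \<open>f\<close> and \<open>g\<close> consists of two one-sided dominations: some positive multiple of \<open>f\<close>
  lies below \<open>g\<close>, and some positive multiple of \<open>g\<close> lies below \<open>f\<close>. The comparing function detects
  each of them separately: \<open>C\<^sub>f(g)\<close> is the supremum of absolute values over a bounded set of scalars
  containing \<open>0\<close>, so it is nonzero exactly if the set contains a nonzero scalar \<open>a\<close>, and then \<open>\<bar>a\<bar> f \<le> g\<close> is
  the first domination (\<open>comparing_function_nonzero_iff\<close>). A product of two reals is nonzero
  iff both factors are, which turns the pair of dominations into the condition on
  \<open>C\<^sub>f(g) C\<^sub>g(f)\<close>.
\<close>

lemma equivalent_norms_iff_mutual_domination:
  "equivalent_norms f g \<longleftrightarrow>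
     (\<exists>l>0. \<forall>x. l * f x \<le> g x) \<and> (\<exists>m>0. \<forall>x. m * g x \<le> f x)"
proof
  assume "equivalent_norms f g"
  then obtain l m where "l > 0" "m > 0" and lm: "\<And>x. l * f x \<le> g x" "\<And>x. g x \<le> m * f x"
    unfolding equivalent_norms_def by blast
  moreover have "inverse m * g x \<le> f x" for x
    using lm(2)[of x] \<open>m > 0\<close> by (simp add: field_simps)
  ultimately show "(\<exists>l>0. \<forall>x. l * f x \<le> g x) \<and> (\<exists>m>0. \<forall>x. m * g x \<le> f x)"
    by (meson positive_imp_inverse_positive)
next
  assume "(\<exists>l>0. \<forall>x. l * f x \<le> g x) \<and> (\<exists>m>0. \<forall>x. m * g x \<le> f x)"
  then obtain l m where "l > 0" "m > 0" and lm: "\<And>x. l * f x \<le> g x" "\<And>x. m * g x \<le> f x"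
    by blast
  moreover have "g x \<le> inverse m * f x" for x
    using lm(2)[of x] \<open>m > 0\<close> by (simp add: field_simps)
  ultimately show "equivalent_norms f g"
    unfolding equivalent_norms_def by (meson positive_imp_inverse_positive)
qed

text \<open>
  Membership in the spectrum depends on a scalar only through its absolute value, and every
  \<open>l \<ge> 0\<close> is the absolute value of the scalar \<open>of_real l\<close>. So over any real normed field the spectrum
  records exactly the constants \<open>l \<ge> 0\<close> with \<open>l f \<le> g\<close>. The condition \<open>f \<noteq> 0\<close> bounds these constants,
  so that a positive one among them really bounds the supremum from below.
\<close>

lemma comparing_function_nonzero_iff:
  fixes scale :: "'k::real_normed_field \<Rightarrow> 'a::ab_group_add \<Rightarrow> 'a"
  assumes f: "f \<in> norms_and_zero scale" "f \<noteq> (\<lambda>_. 0)" and g: "g \<in> norms_and_zero scale"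
  shows "comparing_function TYPE('k) f g \<noteq> 0 \<longleftrightarrow> (\<exists>l>0. \<forall>x. l * f x \<le> g x)"
proof
  let ?S = "comparing_spectrum f g :: 'k set"
  assume nz: "comparing_function TYPE('k) f g \<noteq> 0"
  have "\<exists>a\<in>?S. a \<noteq> 0"
  proof (rule ccontr)
    assume "\<not> (\<exists>a\<in>?S. a \<noteq> 0)"
    moreover have "?S \<noteq> {}"
      using g by (rule comparing_spectrum_nonempty)
    ultimately have "?S = {0}" by auto
    with nz show False by (simp add: comparing_function_def)
  qed
  then obtain a where "a \<in> ?S" "a \<noteq> 0" by blast
  then have "norm a > 0" "\<forall>x. norm a * f x \<le> g x"
    by (simp_all add: comparing_spectrum_def fun_scale_def le_fun_def)
  then show "\<exists>l>0. \<forall>x. l * f x \<le> g x" by blast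
next
  assume "\<exists>l>0. \<forall>x. l * f x \<le> g x"
  then obtain l where "l > 0" and l: "\<forall>x. l * f x \<le> g x" by blast
  then have "(of_real l :: 'k) \<in> comparing_spectrum f g"
    by (simp add: comparing_spectrum_def fun_scale_def le_fun_def)
  from cSUP_upper[OF this comparing_spectrum_bdd_above[OF f]]
  have "l \<le> comparing_function TYPE('k) f g"
    using \<open>l > 0\<close> by (simp add: comparing_function_def)
  with \<open>l > 0\<close> show "comparing_function TYPE('k) f g \<noteq> 0" by simp
qed

lemma is_norm_not_zero_fun:
  fixes f :: "'a::ab_group_add \<Rightarrow> real"
  assumes "is_norm scale f" "(UNIV :: 'a set) \<noteq> {0}"
  shows "f \<noteq> (\<lambda>_. 0)"
  using assms by (auto simp: is_norm_def)

lemma equivalent_norms_iff_comparing_functions_nonzero: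
  fixes scale :: "'k::real_normed_field \<Rightarrow> 'a::ab_group_add \<Rightarrow> 'a"
  assumes "is_norm scale f" "is_norm scale g" "(UNIV :: 'a set) \<noteq> {0}"
  shows "equivalent_norms f g \<longleftrightarrow>
    comparing_function TYPE('k) f g * comparing_function TYPE('k) g f \<noteq> 0"
proof -
  have mem: "f \<in> norms_and_zero scale" "g \<in> norms_and_zero scale"
    using assms by (simp_all add: norms_and_zero_def)
  have ne: "f \<noteq> (\<lambda>_. 0)" "g \<noteq> (\<lambda>_. 0)"
    using assms is_norm_not_zero_fun by blast+
  show ?thesis
    unfolding equivalent_norms_iff_mutual_domination mult_eq_0_iff de_Morgan_disj
      comparing_function_nonzero_iff[OF mem(1) ne(1) mem(2)]
      comparing_function_nonzero_iff[OF mem(2) ne(2) mem(1)] ..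
qed

theorem theorem4p7:
  fixes scale_real :: "real \<Rightarrow> 'a::ab_group_add \<Rightarrow> 'a"
    and scale_complex :: "complex \<Rightarrow> 'a \<Rightarrow> 'a"
    and f g :: "'a \<Rightarrow> real"
  assumes "(UNIV :: 'a set) \<noteq> {0}"
  shows "(vector_space scale_real \<and> is_norm scale_real f \<and> is_norm scale_real g \<longrightarrow>
            (equivalent_norms f g \<longleftrightarrow>
              comparing_function TYPE(real) f g * comparing_function TYPE(real) g f \<noteq> 0)) \<and>
         (vector_space scale_complex \<and> is_norm scale_complex f \<and> is_norm scale_complex g \<longrightarrow>
            (equivalent_norms f g \<longleftrightarrow>
              comparing_function TYPE(complex) f g * comparing_function TYPE(complex) g f \<noteq> 0))"
  using equivalent_norms_iff_comparing_functions_nonzero[of scale_real f g]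
    equivalent_norms_iff_comparing_functions_nonzero[of scale_complex f g] assms
  by blast

end
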